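(* Consider the leader's problem: for any prompt $x\in X$, $$r^*=\arg\max_{r}\ \mathbb{E}_{y\sim\rho_r(\cdot\mid x)}\big[r_U(x,y)\big]$$ over reward models $r:X\times Y\to\mathbb{R}$ satisfying $0\le r(x,y)\le B$ for all $y\in Y$, where $\rho_r(\cdot\mid x)$ is the follower's KL-regularized best response to $r$. The optimal solution $r^*$ to this problem is a threshold reward model $r_{m^*}$ for some threshold function $m^*:X\to\mathbb{R}$; that is, for all $x\in X$, $y\in Y$, $$r^*(x,y)=r_{m^*}(x,y)\ \begin{cases}=0 & \text{if } r_U(x,y)<m^*(x),\\ \in[0,B] & \text{if } r_U(x,y)=m^*(x),\\ =B & \text{if } r_U(x,y)>m^*(x).\end{cases}$$ Moreover, the threshold function $m^*$ of the optimal reward model satisfies $$m^*(x)=\mathbb{E}_{y\sim\rho_{r_{m^*}}(\cdot\mid x)}\big[r_U(x,y)\big]\qquad\text{for all } x\in X.$$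
   Context: $X$ is the set of prompts and $Y$ the space of responses; $\Delta(Y)$ denotes the set of probability distributions over $Y$. The base policy is a map $\rho_{\mathrm{base}}:X\to\Delta(Y)$. The function $r_U:X\times Y\to\mathbb{R}$ is the user's utility (the reward learned from the user's preferences), $B$ is the reward bound, and $\beta>0$ is the hyperparameter controlling the strength of the KL regularization. A reward model is a function $r:X\times Y\to\mathbb{R}$. The follower's best response to a reward model $r$ is, for each $x\in X$, $$\rho_r(\cdot\mid x)=\arg\max_{\rho(\cdot\mid x)\in\Delta(Y)}\Big\{\mathbb{E}_{y\sim\rho(\cdot\mid x)}[r(x,y)]-\beta\, D_{\mathrm{KL}}\big(\rho(\cdot\mid x)\,\|\,\rho_{\mathrm{base}}(\cdot\mid x)\big)\Big\},$$ which has the unique closed-form solution $\rho_r(y\mid x)=\rho_{\mathrm{base}}(y\mid x)\exp(r(x,y)/\beta)/Z_r(x)$, where $Z_r(x)$ is the normalizing term (partition function). Given a function $m:X\to\mathbb{R}$, a threshold reward model $r_m$ is a reward model with $r_m(x,y)=0$ if $r_U(x,y)<m(x)$, $r_m(x,y)\in[0,B]$ if $r_U(x,y)=m(x)$, and $r_m(x,y)=B$ if $r_U(x,y)>m(x)$.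
   Formalization: Some optimal r* is a threshold model at every y, but an arbitrary optimal r* equals one only almost surely under ρ_base(·|x), as responses of base probability zero do not affect the objective; r is measurable in y and r_U(x,·) is integrable under ρ_base(·|x). *)

theory Defs
  imports "HOL-Probability.Probability"
begin

text \<open>
  The responses form a measurable space \<open>M\<close> (for discrete responses, \<open>count_space UNIV\<close>), so that
  \<open>\<Delta>(Y)\<close> is \<open>space (prob_algebra M)\<close>. Prompts are the elements of the type \<open>'x\<close>. A reward model is
  a function \<open>'x \<Rightarrow> 'y \<Rightarrow> real\<close>, measurable in the response.
\<close>

text \<open>
  \<open>KL_div P Q\<close> is \<open>D_KL(P || Q)\<close>, with values in the extended reals. The library's real-valued
  \<open>KL_divergence b Q P\<close> has its arguments the other way round, and is the divergence only if \<open>P\<close> is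
  absolutely continuous with respect to \<open>Q\<close> and the log-density is \<open>P\<close>-integrable. In all other
  cases the divergence is infinite, because the negative part of the log-density is always
  \<open>P\<close>-integrable.
\<close>

definition KL_div :: "'y measure \<Rightarrow> 'y measure \<Rightarrow> ereal" where
  "KL_div P Q =
    (if absolutely_continuous Q P \<and> integrable P (entropy_density (exp 1) Q P)
     then ereal (KL_divergence (exp 1) Q P) else \<infinity>)"

definition follower_objective ::
    "('x \<Rightarrow> 'y measure) \<Rightarrow> real \<Rightarrow> ('x \<Rightarrow> 'y \<Rightarrow> real) \<Rightarrow> 'x \<Rightarrow> 'y measure \<Rightarrow> ereal" where
  "follower_objective base \<beta> r x \<rho> =
    ereal (\<integral>y. r x y \<partial>\<rho>) - ereal \<beta> * KL_div \<rho> (base x)"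

definition best_response ::
    "'y measure \<Rightarrow> ('x \<Rightarrow> 'y measure) \<Rightarrow> real \<Rightarrow> ('x \<Rightarrow> 'y \<Rightarrow> real) \<Rightarrow> 'x \<Rightarrow> 'y measure" where
  "best_response M base \<beta> r x =
    arg_max (follower_objective base \<beta> r x) (\<lambda>\<rho>. \<rho> \<in> space (prob_algebra M))"

definition user_value ::
    "'y measure \<Rightarrow> ('x \<Rightarrow> 'y measure) \<Rightarrow> real \<Rightarrow> ('x \<Rightarrow> 'y \<Rightarrow> real) \<Rightarrow> ('x \<Rightarrow> 'y \<Rightarrow> real) \<Rightarrow> 'x \<Rightarrow> real"
  where
  "user_value M base \<beta> rU r x = (\<integral>y. rU x y \<partial>(best_response M base \<beta> r x))"

definition feasible_at :: "'y measure \<Rightarrow> real \<Rightarrow> 'x \<Rightarrow> ('x \<Rightarrow> 'y \<Rightarrow> real) \<Rightarrow> bool" where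
  "feasible_at M B x r \<longleftrightarrow>
    r x \<in> borel_measurable M \<and> (\<forall>y\<in>space M. 0 \<le> r x y \<and> r x y \<le> B)"

definition leader_optimal ::
    "'y measure \<Rightarrow> ('x \<Rightarrow> 'y measure) \<Rightarrow> real \<Rightarrow> real \<Rightarrow> ('x \<Rightarrow> 'y \<Rightarrow> real) \<Rightarrow> ('x \<Rightarrow> 'y \<Rightarrow> real) \<Rightarrow> bool"
  where
  "leader_optimal M base \<beta> B rU r \<longleftrightarrow>
    (\<forall>x. is_arg_max (\<lambda>r. user_value M base \<beta> rU r x) (feasible_at M B x) r)"

definition threshold_reward_model ::
    "'y measure \<Rightarrow> real \<Rightarrow> ('x \<Rightarrow> 'y \<Rightarrow> real) \<Rightarrow> ('x \<Rightarrow> real) \<Rightarrow> ('x \<Rightarrow> 'y \<Rightarrow> real) \<Rightarrow> bool" where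
  "threshold_reward_model M B rU m r \<longleftrightarrow>
    (\<forall>x. r x \<in> borel_measurable M \<and>
      (\<forall>y\<in>space M.
        (rU x y < m x \<longrightarrow> r x y = 0) \<and>
        (rU x y = m x \<longrightarrow> r x y \<in> {0..B}) \<and>
        (rU x y > m x \<longrightarrow> r x y = B)))"

end

theory Submission
  imports Defs
begin

text \<open>
  By the Gibbs variational principle the best response to \<open>r\<close> is \<open>base x\<close> reweighted by
  \<open>w = exp (r x / \<beta>)\<close>, where \<open>1 \<le> w \<le> K = exp (B / \<beta>)\<close>. Choose \<open>m\<close> such that
  \<open>max (K (u - m)) (u - m)\<close> with \<open>u = rU x\<close> has mean zero under \<open>base x\<close>; this mean is a
  continuous function of \<open>m\<close> that changes sign. Since \<open>(u - m) w \<le> max (K (u - m)) (u - m)\<close>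
  pointwise, the mean of \<open>u\<close> weighted by \<open>w\<close> is at most \<open>m\<close>, with equality iff \<open>w = 1\<close>
  almost everywhere on \<open>u < m\<close> and \<open>w = K\<close> almost everywhere on \<open>u > m\<close>. So \<open>m\<close> is both the
  optimal value and the threshold.
\<close>

section \<open>Nonnegativity of relative entropy\<close>

text \<open>Reduces to \<open>KL_nonneg\<close>, which speaks of an explicit real density: the
  Radon-Nikodym derivative is finite almost everywhere, so its real part \<open>D\<close> still
  satisfies \<open>density M D = N\<close>.\<close>

lemma (in information_space) KL_nonneg_ac:
  assumes "prob_space N"
  assumes ac: "absolutely_continuous M N" "sets N = sets M"
  assumes int: "integrable N (entropy_density b M N)"
  shows "0 \<le> KL_divergence b M N"
proof -
  interpret N: prob_space N by fact
  define D where "D = (\<lambda>x. enn2real (RN_deriv M N x))"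
  have [measurable]: "D \<in> borel_measurable M" and D_nonneg: "0 \<le> D x" for x
    by (simp_all add: D_def)
  have "AE x in M. RN_deriv M N x \<noteq> \<infinity>"
    by (rule RN_deriv_finite[OF _ ac]) unfold_locales
  then have "AE x in M. ennreal (D x) = RN_deriv M N x"
    by eventually_elim (simp add: D_def less_top)
  then have "density M D = density M (RN_deriv M N)"
    by (intro density_cong) auto
  then have N: "density M D = N" using density_RN_deriv[OF ac] by simp
  have "integrable (density M D) (\<lambda>x. log b (D x))"
    using int unfolding N by (simp add: entropy_density_def comp_def D_def)
  then have "integrable M (\<lambda>x. D x * log b (D x))"
    by (subst (asm) integrable_real_density) (auto simp: D_nonneg)
  then have "0 \<le> KL_divergence b M (density M D)"
    using assms(1) by (intro KL_nonneg) (auto simp: N D_nonneg)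
  then show ?thesis by (simp add: N)
qed

section \<open>Exponential tilting and the Gibbs variational principle\<close>

definition gibbs :: "'y measure \<Rightarrow> ('y \<Rightarrow> real) \<Rightarrow> 'y measure" where
  "gibbs Q h = density Q (\<lambda>y. exp (h y) / (\<integral>y. exp (h y) \<partial>Q))"

text \<open>Later \<open>h\<close> is \<open>r x / \<beta>\<close> and \<open>c\<close> is
  \<open>B / \<beta>\<close>. Boundedness makes the partition function positive and finite, and
  makes \<open>h\<close> integrable under every competing distribution.\<close>

locale bounded_tilt = prob_space Q for Q :: "'y measure" +
  fixes h :: "'y \<Rightarrow> real" and c :: real
  assumes measurable_tilt [measurable]: "h \<in> borel_measurable Q"
    and tilt_bound: "y \<in> space Q \<Longrightarrow> \<bar>h y\<bar> \<le> c"
begin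

abbreviation Z :: real where
  "Z \<equiv> \<integral>y. exp (h y) \<partial>Q"

lemma tilt_bounds:
  assumes "y \<in> space Q"
  shows "- c \<le> h y" "h y \<le> c"
  using tilt_bound[OF assms] by auto

lemma integrable_bounded_mult_exp:
  assumes "integrable Q u"
  shows "integrable Q (\<lambda>y. u y * exp (h y))"
proof (rule Bochner_Integration.integrable_bound[of _ "\<lambda>y. exp c * u y"])
  show "AE y in Q. norm (u y * exp (h y)) \<le> norm (exp c * u y)"
  proof (rule AE_I2)
    fix y assume "y \<in> space Q"
    then have "\<bar>u y\<bar> * exp (h y) \<le> \<bar>u y\<bar> * exp c"
      using tilt_bounds by (intro mult_left_mono) auto
    then show "norm (u y * exp (h y)) \<le> norm (exp c * u y)"
      by (simp add: abs_mult mult.commute)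
  qed
qed (use assms in auto)

lemma integrable_exp_tilt: "integrable Q (\<lambda>y. exp (h y))"
  using integrable_bounded_mult_exp[of "\<lambda>_. 1"] by simp

lemma Z_pos: "0 < Z"
proof -
  have "exp (- c) = (\<integral>y. exp (- c) \<partial>Q)" by (simp add: prob_space)
  also have "\<dots> \<le> Z"
    using tilt_bounds by (intro integral_mono integrable_exp_tilt) auto
  finally show ?thesis using exp_gt_zero[of "-c"] by linarith
qed

lemma sets_gibbs [measurable_cong, simp]: "sets (gibbs Q h) = sets Q"
  by (simp add: gibbs_def)

lemma space_gibbs [simp]: "space (gibbs Q h) = space Q"
  by (simp add: gibbs_def)

lemma prob_space_gibbs: "prob_space (gibbs Q h)"
proof
  have "emeasure (gibbs Q h) (space (gibbs Q h)) = (\<integral>\<^sup>+y. ennreal (exp (h y) / Z) \<partial>Q)"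
    by (auto simp: gibbs_def emeasure_density intro!: nn_integral_cong)
  also have "\<dots> = ennreal (\<integral>y. exp (h y) / Z \<partial>Q)"
    using Z_pos integrable_exp_tilt by (intro nn_integral_eq_integral) auto
  also have "\<dots> = 1" using Z_pos by simp
  finally show "emeasure (gibbs Q h) (space (gibbs Q h)) = 1" .
qed

lemma integral_gibbs:
  assumes [measurable]: "u \<in> borel_measurable Q"
  shows "(\<integral>y. u y \<partial>gibbs Q h) = (\<integral>y. u y * exp (h y) \<partial>Q) / Z"
  unfolding gibbs_def using Z_pos
  by (subst integral_real_density) (auto simp: mult.commute)

lemma integrable_tilt:
  assumes "prob_space P" "sets P = sets Q"
  shows "integrable P h"
proof -
  interpret P: prob_space P by fact
  note assms(2)[measurable_cong]
  have "space P = space Q" using assms(2) by (rule sets_eq_imp_space_eq)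
  then have "AE y in P. norm (h y) \<le> c" using tilt_bound by auto
  then show ?thesis by (rule P.integrable_const_bound) measurable
qed

text \<open>The tilt is \<open>exp (h y) / Z\<close> by construction, and Radon-Nikodym derivatives
  are unique up to null sets. The base \<open>exp 1\<close> makes the logarithm natural.\<close>

lemma AE_entropy_density_gibbs:
  "AE y in gibbs Q h. entropy_density (exp 1) Q (gibbs Q h) y = h y - ln Z"
proof -
  have "AE y in Q. ennreal (exp (h y) / Z) = RN_deriv Q (gibbs Q h) y"
    by (rule RN_deriv_unique) (auto simp: gibbs_def)
  then have "AE y in Q. entropy_density (exp 1) Q (gibbs Q h) y = h y - ln Z"
  proof eventually_elim
    case (elim y)
    have "enn2real (RN_deriv Q (gibbs Q h) y) = exp (h y) / Z"
      unfolding elim[symmetric] using Z_pos by simp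
    then show ?case
      using Z_pos by (simp add: entropy_density_def log_def ln_div)
  qed
  then show ?thesis unfolding gibbs_def by (auto simp: AE_density)
qed

lemma absolutely_continuous_gibbs: "absolutely_continuous Q (gibbs Q h)"
  unfolding gibbs_def by (intro absolutely_continuousI_density) auto

text \<open>The log-density is bounded, so the finite branch of \<open>KL_div\<close> applies.
  Consequently the Gibbs measure attains the bound \<open>ln Z\<close> of the variational
  principle.\<close>

lemma KL_div_gibbs: "KL_div (gibbs Q h) Q = ereal ((\<integral>y. h y \<partial>gibbs Q h) - ln Z)"
proof -
  interpret G: prob_space "gibbs Q h" by (rule prob_space_gibbs)
  have ih: "integrable (gibbs Q h) h" by (rule integrable_tilt) (auto intro: prob_space_gibbs)
  have ie: "integrable (gibbs Q h) (entropy_density (exp 1) Q (gibbs Q h))"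
    by (rule integrable_cong_AE[THEN iffD2, OF _ _ AE_entropy_density_gibbs])
       (use ih in auto)
  have "KL_divergence (exp 1) Q (gibbs Q h) = (\<integral>y. h y - ln Z \<partial>gibbs Q h)"
    unfolding KL_divergence_def by (intro integral_cong_AE AE_entropy_density_gibbs) auto
  also have "\<dots> = (\<integral>y. h y \<partial>gibbs Q h) - ln Z"
    using ih by (simp add: G.prob_space[unfolded space_gibbs])
  finally show ?thesis
    using ie absolutely_continuous_gibbs by (simp add: KL_div_def)
qed

text \<open>Chain rule for densities: passing from \<open>Q\<close> to the Gibbs measure multiplies
  the density of \<open>P\<close> by \<open>Z * exp (- h y)\<close>, hence shifts its logarithm by
  \<open>- h y + ln Z\<close>.\<close>

lemma KL_change_reference:
  assumes P: "prob_space P" "sets P = sets Q"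
    and ac: "absolutely_continuous Q P"
    and int: "integrable P (entropy_density (exp 1) Q P)"
  shows "absolutely_continuous (gibbs Q h) P"
    and "integrable P (entropy_density (exp 1) (gibbs Q h) P)"
    and "KL_divergence (exp 1) (gibbs Q h) P =
      KL_divergence (exp 1) Q P - (\<integral>y. h y \<partial>P) + ln Z"
proof -
  interpret P: prob_space P by fact
  interpret G: prob_space "gibbs Q h" by (rule prob_space_gibbs)
  note P(2)[measurable_cong]
  have "finite_measure P" by unfold_locales
  from real_RN_deriv[OF this ac P(2)] obtain D where D [measurable]: "D \<in> borel_measurable Q"
    and RN: "AE y in Q. RN_deriv Q P y = ennreal (D y)"
    and D_pos: "AE y in P. 0 < D y" and D_nonneg: "\<And>y. 0 \<le> D y"
    by this auto
  have "P = density Q (RN_deriv Q P)"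
    using ac P(2) by (rule density_RN_deriv[symmetric])
  also have "\<dots> = density Q D" using RN by (auto intro!: density_cong)
  finally have PD: "P = density Q D" .
  \<comment> \<open>\<open>E\<close> is \<open>D\<close> divided by the Gibbs density, the candidate
    for the density of \<open>P\<close> with respect to \<open>gibbs Q h\<close>.\<close>
  define E where "E = (\<lambda>y. D y * Z * exp (- h y))"
  have [measurable]: "E \<in> borel_measurable Q" by (simp add: E_def)
  have "density (gibbs Q h) E = density Q (\<lambda>y. ennreal (exp (h y) / Z) * ennreal (E y))"
    unfolding gibbs_def by (rule density_density_eq) auto
  also have "\<dots> = density Q D"
  proof (intro density_cong AE_I2)
    fix y
    have "exp (h y) / Z * E y = D y"
      using Z_pos by (simp add: E_def exp_minus field_simps)
    then show "ennreal (exp (h y) / Z) * ennreal (E y) = ennreal (D y)"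
      using Z_pos D_nonneg[of y] by (subst ennreal_mult'[symmetric]) (auto simp: E_def)
  qed auto
  finally have PE: "density (gibbs Q h) E = P" using PD by simp
  show acG: "absolutely_continuous (gibbs Q h) P"
    unfolding PE[symmetric] by (intro absolutely_continuousI_density) auto
  have "AE y in gibbs Q h. ennreal (E y) = RN_deriv (gibbs Q h) P y"
    by (rule G.RN_deriv_unique) (auto simp: PE)
  then have "AE y in P. ennreal (E y) = RN_deriv (gibbs Q h) P y"
    using absolutely_continuous_AE[OF _ acG] P(2) by simp
  moreover have "AE y in P. RN_deriv Q P y = ennreal (D y)"
    using absolutely_continuous_AE[OF P(2) ac RN] .
  \<comment> \<open>The logarithm of the product \<open>E\<close> splits only where \<open>D\<close>
    is positive, which holds \<open>P\<close>-almost everywhere.\<close>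
  ultimately have AE: "AE y in P. entropy_density (exp 1) (gibbs Q h) P y =
      entropy_density (exp 1) Q P y - h y + ln Z"
    using D_pos
  proof eventually_elim
    case (elim y)
    have "enn2real (RN_deriv (gibbs Q h) P y) = D y * Z * exp (- h y)"
      unfolding elim(1)[symmetric] using Z_pos elim(3) by (simp add: E_def)
    then show ?case
      using Z_pos elim(2,3) by (simp add: entropy_density_def log_def ln_mult)
  qed
  have ih: "integrable P h" by (rule integrable_tilt) fact+
  show "integrable P (entropy_density (exp 1) (gibbs Q h) P)"
    by (rule integrable_cong_AE[THEN iffD2, OF _ _ AE]) (use ih int in auto)
  have "KL_divergence (exp 1) (gibbs Q h) P =
      (\<integral>y. entropy_density (exp 1) Q P y - h y + ln Z \<partial>P)"
    unfolding KL_divergence_def by (intro integral_cong_AE AE) auto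
  also have "\<dots> = KL_divergence (exp 1) Q P - (\<integral>y. h y \<partial>P) + ln Z"
    using ih int by (simp add: P.prob_space KL_divergence_def)
  finally show "KL_divergence (exp 1) (gibbs Q h) P =
      KL_divergence (exp 1) Q P - (\<integral>y. h y \<partial>P) + ln Z" .
qed

text \<open>The gap between the two sides is the divergence of \<open>P\<close> from the Gibbs
  measure, which vanishes only if they coincide. If \<open>KL_div P Q\<close> is infinite, the left
  side is minus infinity.\<close>

lemma gibbs_variational:
  assumes P: "prob_space P" "sets P = sets Q" and "P \<noteq> gibbs Q h"
  shows "ereal (\<integral>y. h y \<partial>P) - KL_div P Q < ereal (ln Z)"
proof (cases "absolutely_continuous Q P \<and> integrable P (entropy_density (exp 1) Q P)")
  case True
  interpret G: prob_space "gibbs Q h" by (rule prob_space_gibbs)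
  interpret G: information_space "gibbs Q h" "exp 1" by standard simp
  note ref = KL_change_reference[OF P conjunct1[OF True] conjunct2[OF True]]
  have "sets P = sets (gibbs Q h)" using P by simp
  with G.KL_nonneg_ac G.KL_eq_0_iff_eq_ac P ref(1,2) \<open>P \<noteq> gibbs Q h\<close>
  have "0 < KL_divergence (exp 1) (gibbs Q h) P" by (metis order_le_less)
  with ref(3) True show ?thesis by (simp add: KL_div_def)
next
  case False
  then have "KL_div P Q = \<infinity>" unfolding KL_div_def by (rule if_not_P)
  then show ?thesis by simp
qed

end

section \<open>Closed form of the follower's best response\<close>

lemma bounded_tilt_reward:
  assumes "\<beta> > 0" "base x \<in> space (prob_algebra M)" "feasible_at M B x r"
  shows "bounded_tilt (base x) (\<lambda>y. r x y / \<beta>) (B / \<beta>)"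
proof -
  have s: "sets (base x) = sets M" "prob_space (base x)"
    using assms(2) by (auto simp: space_prob_algebra)
  have [measurable]: "r x \<in> borel_measurable (base x)"
    using assms(3) by (simp add: feasible_at_def measurable_cong_sets[OF s(1) refl])
  show ?thesis
    using s assms sets_eq_imp_space_eq[OF s(1)]
    by (auto simp: bounded_tilt_def bounded_tilt_axioms_def feasible_at_def divide_right_mono)
qed

text \<open>Up to the factor \<open>\<beta>\<close>, the objective is the functional of
  \<open>gibbs_variational\<close> with tilt \<open>r x / \<beta>\<close>, so the Gibbs measure is
  its strict maximizer.\<close>

lemma best_response_eq_gibbs:
  assumes "\<beta> > 0" "base x \<in> space (prob_algebra M)" "feasible_at M B x r"
  shows "best_response M base \<beta> r x = gibbs (base x) (\<lambda>y. r x y / \<beta>)"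
proof -
  interpret bounded_tilt "base x" "\<lambda>y. r x y / \<beta>" "B / \<beta>"
    by (rule bounded_tilt_reward) fact+
  have s: "sets (base x) = sets M"
    using assms(2) by (auto simp: space_prob_algebra)
  let ?G = "gibbs (base x) (\<lambda>y. r x y / \<beta>)"
  let ?f = "follower_objective base \<beta> r x"
  \<comment> \<open>For a finite divergence this is real algebra; for an infinite one both sides are
    the same infinity.\<close>
  have f: "?f P = ereal \<beta> * (ereal (\<integral>y. r x y / \<beta> \<partial>P) - KL_div P (base x))" for P
  proof (cases "KL_div P (base x)")
    case (real k)
    have "\<beta> * ((\<integral>y. r x y \<partial>P) / \<beta> - k) = (\<integral>y. r x y \<partial>P) - \<beta> * k"
      using assms(1) by (simp add: right_diff_distrib)
    then show ?thesis by (simp add: follower_objective_def real)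
  qed (use assms(1) in \<open>simp_all add: follower_objective_def\<close>)
  have G: "?f ?G = ereal \<beta> * ereal (ln Z)"
    unfolding f KL_div_gibbs by simp
  have GP: "?G \<in> space (prob_algebra M)"
    using prob_space_gibbs s by (auto simp: space_prob_algebra)
  have less: "?f P < ?f ?G" if "P \<in> space (prob_algebra M)" "P \<noteq> ?G" for P
  proof -
    have "ereal (\<integral>y. r x y / \<beta> \<partial>P) - KL_div P (base x) < ereal (ln Z)"
      using that s by (intro gibbs_variational) (auto simp: space_prob_algebra)
    then show ?thesis
      unfolding G unfolding f using assms(1) by (intro ereal_mult_strict_left_mono) auto
  qed
  show ?thesis
    unfolding best_response_def arg_max_def
  \<comment> \<open>\<open>arg_max\<close> is a Hilbert choice, so its value is known only because
    the maximizer is unique.\<close>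
  proof (rule some_equality)
    have "?f P \<le> ?f ?G" if "P \<in> space (prob_algebra M)" for P
      using less[OF that] by (cases "P = ?G") (auto intro: less_imp_le)
    then show "is_arg_max ?f (\<lambda>\<rho>. \<rho> \<in> space (prob_algebra M)) ?G"
      unfolding is_arg_max_linorder using GP by blast
    show "P = ?G" if "is_arg_max ?f (\<lambda>\<rho>. \<rho> \<in> space (prob_algebra M)) P" for P
      using that less[of P] GP unfolding is_arg_max_def by blast
  qed
qed

section \<open>The balanced threshold and weighted means\<close>

text \<open>Intermediate value theorem: as a function of \<open>m\<close> the mean is Lipschitz,
  nonnegative at \<open>- A\<close> and nonpositive at \<open>K * A\<close>, where \<open>A\<close>
  is the mean of \<open>\<bar>u y\<bar>\<close>.\<close>

lemma (in prob_space) balanced_threshold_exists: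
  fixes u :: "'a \<Rightarrow> real"
  assumes u: "integrable M u" and "1 \<le> K"
  shows "\<exists>m. (\<integral>y. max (K * (u y - m)) (u y - m) \<partial>M) = 0"
proof -
  define \<phi> where "\<phi> = (\<lambda>t. max (K * t) t)"
  define F where "F = (\<lambda>m. \<integral>y. \<phi> (u y - m) \<partial>M)"
  have int: "integrable M (\<lambda>y. \<phi> (u y - m))" for m
    unfolding \<phi>_def using u by (intro integrable_max integrable_mult_right) auto
  \<comment> \<open>Written as the identity plus \<open>K - 1\<close> times the positive part,
    \<open>\<phi>\<close> visibly has Lipschitz constant \<open>1 + (K - 1) = K\<close>.\<close>
  have \<phi>_eq: "\<phi> t = t + (K - 1) * max 0 t" for t
    using \<open>1 \<le> K\<close> mult_right_mono[of 1 K t] mult_right_mono_neg[of 1 K t]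
    by (auto simp: \<phi>_def max_def algebra_simps)
  have lip: "\<phi> s - \<phi> t \<le> K * \<bar>s - t\<bar>" for s t
  proof -
    have "(K - 1) * (max 0 s - max 0 t) \<le> (K - 1) * \<bar>s - t\<bar>"
      using \<open>1 \<le> K\<close> by (intro mult_left_mono) auto
    then show ?thesis using abs_ge_self[of "s - t"] by (simp add: \<phi>_eq algebra_simps)
  qed
  have "F a - F b \<le> K * \<bar>a - b\<bar>" for a b
  proof -
    have "F a - F b = (\<integral>y. \<phi> (u y - a) - \<phi> (u y - b) \<partial>M)"
      unfolding F_def using int by simp
    also have "\<dots> \<le> (\<integral>y. K * \<bar>a - b\<bar> \<partial>M)"
      using int lip by (intro integral_mono) (auto, smt (verit))
    finally show ?thesis by (simp add: prob_space)
  qed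
  then have "K-lipschitz_on UNIV F"
    using \<open>1 \<le> K\<close> by (intro lipschitz_onI) (auto simp: dist_real_def abs_le_iff, smt (verit))
  then have cont: "isCont F m" for m
    using lipschitz_on_continuous_on continuous_on_eq_continuous_at open_UNIV by blast
  have abs_u: "integrable M (\<lambda>y. \<bar>u y\<bar>)" using u by simp
  define A where "A = (\<integral>y. \<bar>u y\<bar> \<partial>M)"
  have A: "0 \<le> A" "\<bar>\<integral>y. u y \<partial>M\<bar> \<le> A" by (auto simp: A_def)
  have KA: "0 \<le> K * A" using A \<open>1 \<le> K\<close> by simp
  \<comment> \<open>The endpoint \<open>K * A\<close> is chosen so that the majorant
    \<open>K * \<bar>u y\<bar> - K * A\<close> has mean zero.\<close>
  have "F (K * A) \<le> (\<integral>y. K * \<bar>u y\<bar> - K * A \<partial>M)"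
    unfolding F_def
  proof (intro integral_mono int)
    fix y
    have "(K - 1) * max 0 (u y - K * A) \<le> (K - 1) * \<bar>u y\<bar>"
      using \<open>1 \<le> K\<close> KA by (intro mult_left_mono) auto
    then show "\<phi> (u y - K * A) \<le> K * \<bar>u y\<bar> - K * A"
      by (simp add: \<phi>_eq algebra_simps)
  qed (use abs_u in auto)
  also have "\<dots> = 0" using abs_u by (simp add: prob_space A_def)
  finally have upper: "F (K * A) \<le> 0" .
  \<comment> \<open>At \<open>- A\<close> the bound \<open>t \<le> \<phi> t\<close> suffices, since
    the mean of \<open>u\<close> is at least \<open>- A\<close>.\<close>
  have "0 \<le> (\<integral>y. u y + A \<partial>M)" using u A by (simp add: prob_space)
  also have "\<dots> \<le> F (- A)"
    unfolding F_def using int u by (intro integral_mono) (auto simp: \<phi>_def)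
  finally have lower: "0 \<le> F (- A)" .
  have "\<exists>m. - A \<le> m \<and> m \<le> K * A \<and> F m = 0"
    using upper lower cont A KA by (intro IVT2) auto
  then show ?thesis by (auto simp: F_def \<phi>_def)
qed

text \<open>The pointwise gap \<open>?\<phi> y - (u y - m) * w y\<close> is nonnegative and
  integrates to \<open>m\<close> times the mean of \<open>w\<close> minus the mean of
  \<open>u * w\<close>. Equality forces the gap to vanish almost everywhere.\<close>

lemma (in prob_space) weighted_mean_le_threshold:
  fixes u w :: "'a \<Rightarrow> real"
  assumes u: "integrable M u" and "1 \<le> K"
    and w [measurable]: "w \<in> borel_measurable M"
    and w_bounds: "\<And>y. y \<in> space M \<Longrightarrow> 1 \<le> w y \<and> w y \<le> K"
    and m: "(\<integral>y. max (K * (u y - m)) (u y - m) \<partial>M) = 0"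
  shows "(\<integral>y. u y * w y \<partial>M) / (\<integral>y. w y \<partial>M) \<le> m"
    and "(\<integral>y. u y * w y \<partial>M) / (\<integral>y. w y \<partial>M) = m \<longleftrightarrow>
      (AE y in M. (u y < m \<longrightarrow> w y = 1) \<and> (u y > m \<longrightarrow> w y = K))"
proof -
  let ?\<phi> = "\<lambda>y. max (K * (u y - m)) (u y - m)"
  have int_\<phi>: "integrable M ?\<phi>"
    using u by (intro integrable_max integrable_mult_right) auto
  have int_w: "integrable M w"
    using w_bounds by (intro integrable_const_bound[of _ K]) (auto, fastforce)
  have int_uw: "integrable M (\<lambda>y. u y * w y)"
  proof (rule Bochner_Integration.integrable_bound[of _ "\<lambda>y. K * u y"])
    show "AE y in M. norm (u y * w y) \<le> norm (K * u y)"
    proof (rule AE_I2)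
      fix y assume "y \<in> space M"
      with w_bounds[of y] have "\<bar>u y\<bar> * \<bar>w y\<bar> \<le> \<bar>u y\<bar> * \<bar>K\<bar>"
        by (intro mult_left_mono) auto
      then show "norm (u y * w y) \<le> norm (K * u y)"
        by (simp add: abs_mult mult.commute)
    qed
  qed (use u in auto)
  have "(\<integral>y. 1 \<partial>M) \<le> (\<integral>y. w y \<partial>M)"
    using int_w w_bounds by (intro integral_mono) auto
  then have W: "1 \<le> (\<integral>y. w y \<partial>M)" by (simp add: prob_space)
  \<comment> \<open>Where \<open>u y \<ge> m\<close> the bound \<open>w y \<le> K\<close> is used;
    elsewhere \<open>u y - m\<close> is negative and \<open>1 \<le> w y\<close> is used.\<close>
  have le: "(u y - m) * w y \<le> ?\<phi> y" if "y \<in> space M" for y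
    using w_bounds[OF that] mult_left_mono[of "w y" K "u y - m"]
      mult_left_mono_neg[of 1 "w y" "u y - m"]
    by (cases "u y \<ge> m") (auto simp: mult.commute le_max_iff_disj)
  \<comment> \<open>The gap factors as \<open>(u y - m) * (1 - w y)\<close> below \<open>m\<close>
    and \<open>(u y - m) * (K - w y)\<close> above. At \<open>u y = m\<close> it is zero for every
    \<open>w y\<close>, hence the freedom on ties.\<close>
  have eq: "?\<phi> y - (u y - m) * w y = 0 \<longleftrightarrow>
      (u y < m \<longrightarrow> w y = 1) \<and> (u y > m \<longrightarrow> w y = K)" for y
  proof -
    have "?\<phi> y = (if u y < m then u y - m else K * (u y - m))"
      using \<open>1 \<le> K\<close> mult_right_mono[of 1 K "u y - m"] mult_right_mono_neg[of 1 K "u y - m"]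
      by (auto simp: max_def)
    then show ?thesis by auto
  qed
  have int_d: "integrable M (\<lambda>y. ?\<phi> y - (u y - m) * w y)"
    using int_\<phi> int_uw int_w by (auto simp: left_diff_distrib)
  have "(\<integral>y. ?\<phi> y - (u y - m) * w y \<partial>M) = (\<integral>y. ?\<phi> y \<partial>M) - (\<integral>y. u y * w y - m * w y \<partial>M)"
    using int_\<phi> int_uw int_w by (simp add: left_diff_distrib)
  then have d: "(\<integral>y. ?\<phi> y - (u y - m) * w y \<partial>M) = m * (\<integral>y. w y \<partial>M) - (\<integral>y. u y * w y \<partial>M)"
    using int_uw int_w m by simp
  have nonneg: "AE y in M. 0 \<le> ?\<phi> y - (u y - m) * w y" using le by auto
  have "0 \<le> (\<integral>y. ?\<phi> y - (u y - m) * w y \<partial>M)"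
    using nonneg by (rule integral_nonneg_AE)
  then show "(\<integral>y. u y * w y \<partial>M) / (\<integral>y. w y \<partial>M) \<le> m"
    using W d by (simp add: divide_le_eq)
  have "(\<integral>y. u y * w y \<partial>M) / (\<integral>y. w y \<partial>M) = m \<longleftrightarrow>
      (\<integral>y. ?\<phi> y - (u y - m) * w y \<partial>M) = 0"
    using W unfolding d by (auto simp: field_simps)
  also have "\<dots> \<longleftrightarrow> (AE y in M. ?\<phi> y - (u y - m) * w y = 0)"
    by (rule integral_nonneg_eq_0_iff_AE[OF int_d nonneg])
  finally show "(\<integral>y. u y * w y \<partial>M) / (\<integral>y. w y \<partial>M) = m \<longleftrightarrow>
      (AE y in M. (u y < m \<longrightarrow> w y = 1) \<and> (u y > m \<longrightarrow> w y = K))"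
    unfolding eq .
qed

section \<open>The leader's problem\<close>

text \<open>Weights \<open>exp (r x y / \<beta>)\<close> with \<open>K = exp (B / \<beta>)\<close>;
  injectivity of \<open>exp\<close> translates the equality case back to \<open>r\<close>. The
  equation for \<open>m\<close> does not involve \<open>r\<close>, so one \<open>m\<close> bounds
  all feasible rewards.\<close>

lemma user_value_le_threshold:
  assumes "\<beta> > 0" "B \<ge> 0" "base x \<in> space (prob_algebra M)"
    and u: "integrable (base x) (rU x)" and feas: "feasible_at M B x r"
    and m: "(\<integral>y. max (exp (B / \<beta>) * (rU x y - m)) (rU x y - m) \<partial>base x) = 0"
  shows "user_value M base \<beta> rU r x \<le> m"
    and "user_value M base \<beta> rU r x = m \<longleftrightarrow>
      (AE y in base x. (rU x y < m \<longrightarrow> r x y = 0) \<and> (rU x y > m \<longrightarrow> r x y = B))"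
proof -
  interpret bounded_tilt "base x" "\<lambda>y. r x y / \<beta>" "B / \<beta>"
    by (rule bounded_tilt_reward) fact+
  have "space (base x) = space M"
    using assms(3) by (intro sets_eq_imp_space_eq) (simp add: space_prob_algebra)
  then have w: "1 \<le> exp (r x y / \<beta>) \<and> exp (r x y / \<beta>) \<le> exp (B / \<beta>)"
    if "y \<in> space (base x)" for y
    using that feas assms(1) by (auto simp: feasible_at_def divide_right_mono)
  have K: "1 \<le> exp (B / \<beta>)" using assms(1,2) by simp
  have "best_response M base \<beta> r x = gibbs (base x) (\<lambda>y. r x y / \<beta>)"
    by (rule best_response_eq_gibbs) fact+
  then have val: "user_value M base \<beta> rU r x = (\<integral>y. rU x y * exp (r x y / \<beta>) \<partial>base x) / Z"
    using u by (simp add: user_value_def integral_gibbs)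
  have eq: "exp (r x y / \<beta>) = 1 \<longleftrightarrow> r x y = 0"
      "exp (r x y / \<beta>) = exp (B / \<beta>) \<longleftrightarrow> r x y = B" for y
    using assms(1) by auto
  show "user_value M base \<beta> rU r x \<le> m"
    unfolding val by (rule weighted_mean_le_threshold(1)[OF u K _ w m]) measurable
  show "user_value M base \<beta> rU r x = m \<longleftrightarrow>
      (AE y in base x. (rU x y < m \<longrightarrow> r x y = 0) \<and> (rU x y > m \<longrightarrow> r x y = B))"
    unfolding val eq[symmetric]
    by (rule weighted_mean_le_threshold(2)[OF u K _ w m]) measurable
qed

text \<open>The best response ignores rewards on \<open>base x\<close>-null sets, so an arbitrary
  optimal model can be compared with a threshold model only almost everywhere.\<close>

theorem theorem1:
  fixes M :: "'y measure"
    and base :: "'x \<Rightarrow> 'y measure"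
    and rU :: "'x \<Rightarrow> 'y \<Rightarrow> real"
    and \<beta> B :: real
  assumes "\<beta> > 0"
    and "B \<ge> 0"
    and "\<And>x. base x \<in> space (prob_algebra M)"
    and "\<And>x. integrable (base x) (rU x)"
  shows "(\<exists>r m. leader_optimal M base \<beta> B rU r \<and>
            threshold_reward_model M B rU m r \<and>
            (\<forall>x. m x = (\<integral>y. rU x y \<partial>(best_response M base \<beta> r x)))) \<and>
         (\<forall>r. leader_optimal M base \<beta> B rU r \<longrightarrow>
            (\<exists>m rm. threshold_reward_model M B rU m rm \<and>
              (\<forall>x. AE y in base x. r x y = rm x y) \<and>
              (\<forall>x. m x = (\<integral>y. rU x y \<partial>(best_response M base \<beta> rm x)))))"
proof -
  have "\<exists>m. (\<integral>y. max (exp (B / \<beta>) * (rU x y - m)) (rU x y - m) \<partial>base x) = 0" for x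
    using assms by (intro prob_space.balanced_threshold_exists) (auto simp: space_prob_algebra)
  then obtain m where
    m: "\<And>x. (\<integral>y. max (exp (B / \<beta>) * (rU x y - m x)) (rU x y - m x) \<partial>base x) = 0"
    by metis
  have le: "user_value M base \<beta> rU r x \<le> m x"
    and eq_iff: "user_value M base \<beta> rU r x = m x \<longleftrightarrow>
      (AE y in base x. (rU x y < m x \<longrightarrow> r x y = 0) \<and> (rU x y > m x \<longrightarrow> r x y = B))"
    if "feasible_at M B x r" for r x
    by (rule user_value_le_threshold; fact assms(1,2) assms(3,4)[of x] that m[of x])+
  have [measurable]: "rU x \<in> borel_measurable M" for x
  proof -
    have "sets (base x) = sets M" using assms(3) by (simp add: space_prob_algebra)
    note measurable_cong_sets[OF this refl, of borel]
    with borel_measurable_integrable[OF assms(4), of x] show ?thesis by blast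
  qed
  \<comment> \<open>\<open>cut r\<close> imposes the threshold shape everywhere and keeps
    \<open>r\<close> on ties. With the zero reward it is the existence witness; with an optimal
    \<open>r\<close> it is the almost everywhere equal threshold model.\<close>
  define cut where
    "cut r x y = (if rU x y < m x then 0 else if rU x y > m x then B else r x y)"
    for r :: "'x \<Rightarrow> 'y \<Rightarrow> real" and x y
  have feas_cut: "feasible_at M B x (cut r)" and thr_cut: "threshold_reward_model M B rU m (cut r)"
    and val_cut: "user_value M base \<beta> rU (cut r) x = m x"
    if feas: "\<And>x. feasible_at M B x r" for r x
  proof -
    have [measurable]: "r x \<in> borel_measurable M" for x
      using feas by (simp add: feasible_at_def)
    have [measurable]: "cut r x \<in> borel_measurable M" for x
      unfolding cut_def[abs_def] by measurable
    show F: "feasible_at M B x (cut r)"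
      using feas[of x] assms(2) by (auto simp: feasible_at_def cut_def)
    show "threshold_reward_model M B rU m (cut r)"
      using feas by (auto simp: threshold_reward_model_def feasible_at_def cut_def)
    show "user_value M base \<beta> rU (cut r) x = m x"
      unfolding eq_iff[OF F] by (auto simp: cut_def)
  qed
  have feas0: "feasible_at M B x (\<lambda>_ _. 0)" for x
    using assms(2) by (simp add: feasible_at_def)
  let ?r = "cut (\<lambda>_ _. 0)"
  \<comment> \<open>\<open>?r\<close> is optimal because it attains the upper bound
    \<open>m x\<close> at every prompt.\<close>
  have "leader_optimal M base \<beta> B rU ?r"
    using le feas_cut[OF feas0] by (simp add: leader_optimal_def is_arg_max_linorder val_cut[OF feas0])
  moreover have "\<exists>m rm. threshold_reward_model M B rU m rm \<and>
      (\<forall>x. AE y in base x. r x y = rm x y) \<and>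
      (\<forall>x. m x = (\<integral>y. rU x y \<partial>(best_response M base \<beta> rm x)))"
    if opt: "leader_optimal M base \<beta> B rU r" for r
  proof (intro exI conjI allI)
    have feas: "feasible_at M B x r" for x
      using opt by (auto simp: leader_optimal_def is_arg_max_linorder)
    show "threshold_reward_model M B rU m (cut r)" using feas by (rule thr_cut)
    fix x
    \<comment> \<open>An optimal \<open>r\<close> does at least as well as \<open>?r\<close>, hence
      also attains \<open>m x\<close> and falls under the equality case.\<close>
    have "user_value M base \<beta> rU ?r x \<le> user_value M base \<beta> rU r x"
      using opt feas_cut[OF feas0, of x] by (auto simp: leader_optimal_def is_arg_max_linorder)
    with le[OF feas, of x] val_cut[OF feas0, of x] have "user_value M base \<beta> rU r x = m x" by simp
    then have "AE y in base x. (rU x y < m x \<longrightarrow> r x y = 0) \<and> (rU x y > m x \<longrightarrow> r x y = B)"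
      unfolding eq_iff[OF feas] .
    then show "AE y in base x. r x y = cut r x y"
      by eventually_elim (auto simp: cut_def)
    show "m x = (\<integral>y. rU x y \<partial>(best_response M base \<beta> (cut r) x))"
      using val_cut[OF feas, of x] by (simp add: user_value_def)
  qed
  moreover have "threshold_reward_model M B rU m ?r" by (rule thr_cut) (rule feas0)
  moreover have "m x = (\<integral>y. rU x y \<partial>(best_response M base \<beta> ?r x))" for x
    using val_cut[OF feas0, of x] by (simp add: user_value_def)
  ultimately show ?thesis by blast
qed

end
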